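(* Let $K,T\ge1$ and $1\le L_R\le N_R$. (i) Subspace invariance: if $\mathbf{G},\mathbf{G}'\in\mathbb{C}^{L_R\times N_R}$ both have full row rank $L_R$ and $\operatorname{row}(\mathbf{G})=\operatorname{row}(\mathbf{G}')$, then $\mathbf{J}_{\mathrm{MiLAC}}(\boldsymbol{\xi};\mathbf{G})=\mathbf{J}_{\mathrm{MiLAC}}(\boldsymbol{\xi};\mathbf{G}')$. (ii) Row-isometric representation: every $L_R$-dimensional complex subspace $\mathcal{S}\subseteq\mathbb{C}^{N_R}$ is the row space of some $\mathbf{G}_{\mathrm{iso}}\in\mathbb{C}^{L_R\times N_R}$ with $\mathbf{G}_{\mathrm{iso}}\mathbf{G}_{\mathrm{iso}}^{\mathsf H}=\mathbf{I}_{L_R}$.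
   Context: $\mathbf{a}:\mathbb{R}\to\mathbb{C}^{N_R}$ is a differentiable steering-vector function with derivative $\dot{\mathbf{a}}$; $\theta_1,\dots,\theta_K\in\mathbb{R}$ are distinct; $\beta_1,\dots,\beta_K\in\mathbb{C}\setminus\{0\}$; $s_1,\dots,s_T\in\mathbb{C}$ is a known waveform; $\sigma^2>0$. The real parameter vector is $\boldsymbol{\xi}=[\theta_1,\dots,\theta_K,\Re\beta_1,\Im\beta_1,\dots,\Re\beta_K,\Im\beta_K]^{\mathsf T}\in\mathbb{R}^{3K}$. Let $\boldsymbol{\mu}_t=s_t\sum_{k}\beta_k\mathbf{a}(\theta_k)$, so $\partial_{\theta_k}\boldsymbol{\mu}_t=s_t\beta_k\dot{\mathbf{a}}(\theta_k)$, $\partial_{\Re\beta_k}\boldsymbol{\mu}_t=s_t\mathbf{a}(\theta_k)$, $\partial_{\Im\beta_k}\boldsymbol{\mu}_t=js_t\mathbf{a}(\theta_k)$. Let $\mathcal{J}_{\mathrm{dig}}\in\mathbb{C}^{TN_R\times3K}$ be the vertical stack over $t$ of $\partial\boldsymbol{\mu}_t/\partial\boldsymbol{\xi}$. For full-row-rank $\mathbf{G}\in\mathbb{C}^{L_R\times N_R}$ let $$\mathbf{J}_{\mathrm{MiLAC}}(\boldsymbol{\xi};\mathbf{G})=\frac{2}{\sigma^2}\Re\bigl\{\mathcal{J}_{\mathrm{dig}}^{\mathsf H}(\mathbf{I}_T\otimes\mathbf{G})^{\mathsf H}(\mathbf{I}_T\otimes(\mathbf{G}\mathbf{G}^{\mathsf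 H})^{-1})(\mathbf{I}_T\otimes\mathbf{G})\mathcal{J}_{\mathrm{dig}}\bigr\},$$ the Fisher information matrix about $\boldsymbol{\xi}$ in the observations $\mathbf{z}_t=\mathbf{G}\boldsymbol{\mu}_t+\mathbf{G}\mathbf{n}_t$, $\mathbf{n}_t\sim\mathcal{CN}(\mathbf{0},\sigma^2\mathbf{I}_{N_R})$ independent over $t=1,\dots,T$. Convention: $\operatorname{row}(\mathbf{G}):=\operatorname{col}(\mathbf{G}^{\mathsf H})\subseteq\mathbb{C}^{N_R}$. *)

theory Defs
  imports "HOL-Analysis.Analysis"
begin

section \<open>Complex matrices\<close>

definition conj_transpose :: "complex^'n^'m \<Rightarrow> complex^'m^'n"  (\<open>_\<^sup>H\<close> [1000] 999)
  where "A\<^sup>H = transpose (map_matrix cnj A)"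

definition col_space :: "complex^'n^'m \<Rightarrow> (complex^'m) set"
  where "col_space A = vec.span (columns A)"

text \<open>With this convention the row space is spanned by the entrywise conjugates of the rows.\<close>

definition row_space :: "complex^'n^'m \<Rightarrow> (complex^'n) set"
  where "row_space G = col_space (G\<^sup>H)"

definition full_row_rank :: "complex^'n^'m \<Rightarrow> bool"
  where "full_row_rank (G :: complex^'n^'m) \<longleftrightarrow> rank G = CARD('m)"

text \<open>Row and column indices of a Kronecker product are pairs; the first component is the
  block index.\<close>

definition kron :: "complex^'n^'m \<Rightarrow> complex^'q^'p \<Rightarrow> complex^('n \<times> 'q)^('m \<times> 'p)"
    (infixl \<open>\<otimes>\<^sub>K\<close> 75)
  where "A \<otimes>\<^sub>K B = (\<chi> i j. A $ fst i $ fst j * B $ snd i $ snd j)"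

section \<open>Parameters, mean and Jacobian\<close>

text \<open>The real parameter vector of length $3K$: coordinate \<open>Inl k\<close> is the angle
  $\theta_k$, coordinates \<open>Inr (k, False)\<close> and \<open>Inr (k, True)\<close> are the real and the
  imaginary part of $\beta_k$.\<close>

type_synonym 'k param = "'k + 'k \<times> bool"

definition angle :: "real^('k::finite) param \<Rightarrow> 'k \<Rightarrow> real"
  where "angle \<xi> k = \<xi> $ Inl k"

definition gain :: "real^('k::finite) param \<Rightarrow> 'k \<Rightarrow> complex"
  where "gain \<xi> k = Complex (\<xi> $ Inr (k, False)) (\<xi> $ Inr (k, True))"

definition mu :: "(real \<Rightarrow> complex^'n) \<Rightarrow> complex^'t \<Rightarrow> real^('k::finite) param \<Rightarrow> 't \<Rightarrow> complex^'n"
  where "mu a s \<xi> t = (s $ t) *s (\<Sum>k\<in>UNIV. gain \<xi> k *s a (angle \<xi> k))"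

definition partial_deriv ::
    "(real^'p \<Rightarrow> 'b::real_normed_vector) \<Rightarrow> 'p::finite \<Rightarrow> real^'p \<Rightarrow> 'b"
  where "partial_deriv f p \<xi> =
    vector_derivative (\<lambda>x. f (\<chi> q. if q = p then x else \<xi> $ q)) (at (\<xi> $ p))"

definition J_dig :: "(real \<Rightarrow> complex^'n) \<Rightarrow> complex^'t \<Rightarrow> real^('k::finite) param
    \<Rightarrow> complex^'k param^('t \<times> 'n)"
  where "J_dig a s \<xi> = (\<chi> i p. partial_deriv (\<lambda>\<xi>'. mu a s \<xi>' (fst i)) p \<xi> $ snd i)"

definition J_MiLAC :: "(real \<Rightarrow> complex^'n) \<Rightarrow> complex^'t \<Rightarrow> real \<Rightarrow> real^('k::finite) param
    \<Rightarrow> complex^'n^'l \<Rightarrow> real^'k param^'k param"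
  where "J_MiLAC a s \<sigma> \<xi> G =
    (2 / \<sigma>\<^sup>2) *\<^sub>R map_matrix Re
      ((J_dig a s \<xi>)\<^sup>H ** ((mat 1 :: complex^'t^'t) \<otimes>\<^sub>K G)\<^sup>H
        ** ((mat 1 :: complex^'t^'t) \<otimes>\<^sub>K matrix_inv (G ** G\<^sup>H))
        ** ((mat 1 :: complex^'t^'t) \<otimes>\<^sub>K G) ** J_dig a s \<xi>)"

section \<open>The partial derivatives in closed form\<close>

lemma partial_deriv_eqI:
  assumes "((\<lambda>x. f (\<chi> q. if q = p then x else \<xi> $ q)) has_vector_derivative d) (at (\<xi> $ p))"
  shows "partial_deriv f p \<xi> = d"
  unfolding partial_deriv_def using assms by (rule vector_derivative_at)

lemma bounded_linear_vector_scalar_mult: "bounded_linear ((*s) (c :: complex) :: complex^'n \<Rightarrow> _)"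
  by (rule linear_conv_bounded_linear[THEN iffD1], rule linearI)
     (auto simp: vec_eq_iff algebra_simps)

lemma bounded_linear_vector_scalar_mult_left:
  "bounded_linear (\<lambda>c :: complex. c *s (v :: complex^'n))"
  by (rule linear_conv_bounded_linear[THEN iffD1], rule linearI)
     (auto simp: vec_eq_iff algebra_simps)

lemma partial_deriv_mu:
  assumes "\<And>k'. ((\<lambda>x. gain (\<chi> q. if q = p then x else \<xi> $ q) k' *s
      a (angle (\<chi> q. if q = p then x else \<xi> $ q) k')) has_vector_derivative
      (if k' = k then d else 0)) (at (\<xi> $ p))"
  shows "partial_deriv (\<lambda>\<xi>. mu a s \<xi> t) p \<xi> = s $ t *s d"
proof -
  have "((\<lambda>x. \<Sum>k'\<in>UNIV. gain (\<chi> q. if q = p then x else \<xi> $ q) k' *s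
      a (angle (\<chi> q. if q = p then x else \<xi> $ q) k')) has_vector_derivative
      (\<Sum>k'\<in>UNIV. if k' = k then d else 0)) (at (\<xi> $ p))"
    by (intro has_vector_derivative_sum assms)
  from bounded_linear.has_vector_derivative[OF bounded_linear_vector_scalar_mult this, of "s $ t"]
  show ?thesis by (intro partial_deriv_eqI) (simp add: mu_def)
qed

lemma partial_deriv_mu_angle:
  assumes "a differentiable (at (angle \<xi> k))"
  shows "partial_deriv (\<lambda>\<xi>. mu a s \<xi> t) (Inl k) \<xi> =
    (s $ t * gain \<xi> k) *s vector_derivative a (at (angle \<xi> k))"
proof -
  have "(a has_vector_derivative vector_derivative a (at (angle \<xi> k))) (at (\<xi> $ Inl k))"
    using assms by (simp add: vector_derivative_works angle_def)
  from bounded_linear.has_vector_derivative[OF bounded_linear_vector_scalar_mult this]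
  have "partial_deriv (\<lambda>\<xi>. mu a s \<xi> t) (Inl k) \<xi> =
    s $ t *s (gain \<xi> k *s vector_derivative a (at (angle \<xi> k)))"
    by (intro partial_deriv_mu[where k = k]) (auto simp: gain_def angle_def)
  then show ?thesis by simp
qed

lemma partial_deriv_mu_Re:
  "partial_deriv (\<lambda>\<xi>. mu a s \<xi> t) (Inr (k, False)) \<xi> = s $ t *s a (angle \<xi> k)"
proof (rule partial_deriv_mu[where k = k])
  have "((\<lambda>x. Complex x y) has_vector_derivative 1) (at x)" for x y
    unfolding Complex_eq by (auto intro!: derivative_eq_intros)
  from bounded_linear.has_vector_derivative[OF bounded_linear_vector_scalar_mult_left this]
  show "((\<lambda>x. gain (\<chi> q. if q = Inr (k, False) then x else \<xi> $ q) k' *s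
      a (angle (\<chi> q. if q = Inr (k, False) then x else \<xi> $ q) k')) has_vector_derivative
      (if k' = k then a (angle \<xi> k) else 0)) (at (\<xi> $ Inr (k, False)))" for k'
    by (auto simp: gain_def angle_def)
qed

lemma partial_deriv_mu_Im:
  "partial_deriv (\<lambda>\<xi>. mu a s \<xi> t) (Inr (k, True)) \<xi> = (\<i> * s $ t) *s a (angle \<xi> k)"
proof -
  have "((\<lambda>x. Complex y x) has_vector_derivative \<i>) (at x)" for x y
    unfolding Complex_eq by (auto intro!: derivative_eq_intros)
  from bounded_linear.has_vector_derivative[OF bounded_linear_vector_scalar_mult_left this]
  have "partial_deriv (\<lambda>\<xi>. mu a s \<xi> t) (Inr (k, True)) \<xi> = s $ t *s (\<i> *s a (angle \<xi> k))"
    by (intro partial_deriv_mu[where k = k]) (auto simp: gain_def angle_def)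
  then show ?thesis by (simp add: mult.commute)
qed

end

theory Submission
  imports Defs
begin

text \<open>By the mixed-product rule the matrix between the two Jacobians is $I_T \otimes P$ with
  $P = G^H (G G^H)^{-1} G$. Both $P$ and the corresponding $P'$ are Hermitian, and each fixes the
  columns of $G^H$ and of $G'^H$ as soon as the row spaces agree. Hence $P P' = P'$ and
  $P' P = P$, and taking adjoints in the first identity gives $P' = P$. The second part is
  Gram--Schmidt for the Hermitian inner product.\<close>

section \<open>Conjugate transpose and Kronecker product\<close>

lemma conj_transpose_nth [simp]: "A\<^sup>H $ i $ j = cnj (A $ j $ i)"
  by (simp add: conj_transpose_def transpose_def)

lemma conj_transpose_conj_transpose [simp]: "(A\<^sup>H)\<^sup>H = A"
  by (simp add: vec_eq_iff)

lemma conj_transpose_mat_1 [simp]: "(mat 1)\<^sup>H = mat 1"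
  by (auto simp: vec_eq_iff mat_def)

lemma conj_transpose_mult: "(A ** B)\<^sup>H = B\<^sup>H ** A\<^sup>H"
  by (simp add: vec_eq_iff matrix_matrix_mult_def mult.commute)

lemma conj_transpose_kron: "(A \<otimes>\<^sub>K B)\<^sup>H = A\<^sup>H \<otimes>\<^sub>K B\<^sup>H"
  by (simp add: vec_eq_iff kron_def)

text \<open>The summation index of the product is a pair, so the sum over it splits into a product
  of two sums, one for each factor.\<close>

lemma kron_mult: "(A \<otimes>\<^sub>K B) ** (C \<otimes>\<^sub>K D) = (A ** C) \<otimes>\<^sub>K (B ** D)"
  by (simp add: vec_eq_iff kron_def matrix_matrix_mult_def sum_product sum.cartesian_product
      case_prod_unfold mult_ac)

section \<open>The Hermitian inner product\<close>

text \<open>Linear in the first argument and conjugate-linear in the second. The real inner product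
  on \<open>complex^'n\<close> is only the real part of this form; orthogonality over complex
  scalars needs the full value.\<close>

definition herm_inner :: "complex^'n \<Rightarrow> complex^'n \<Rightarrow> complex"
  where "herm_inner x y = (\<Sum>i\<in>UNIV. x $ i * cnj (y $ i))"

lemma herm_inner_add_left: "herm_inner (x + y) z = herm_inner x z + herm_inner y z"
  by (simp add: herm_inner_def algebra_simps sum.distrib)

lemma herm_inner_diff_left: "herm_inner (x - y) z = herm_inner x z - herm_inner y z"
  by (simp add: herm_inner_def algebra_simps sum_subtractf)

lemma herm_inner_scale_left: "herm_inner (c *s x) z = c * herm_inner x z"
  by (simp add: herm_inner_def algebra_simps sum_distrib_left)

lemma herm_inner_scale_right: "herm_inner x (c *s z) = cnj c * herm_inner x z"
  by (simp add: herm_inner_def algebra_simps sum_distrib_left)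

lemma herm_inner_0_left [simp]: "herm_inner 0 z = 0"
  by (simp add: herm_inner_def)

lemma herm_inner_sum_left: "herm_inner (\<Sum>i\<in>A. f i) z = (\<Sum>i\<in>A. herm_inner (f i) z)"
  by (induction A rule: infinite_finite_induct) (auto simp: herm_inner_add_left)

lemma cnj_herm_inner: "cnj (herm_inner x y) = herm_inner y x"
  by (simp add: herm_inner_def mult.commute)

lemma herm_inner_self: "herm_inner x x = of_real ((norm x)\<^sup>2)"
  by (simp add: herm_inner_def norm_vec_def L2_set_def sum_nonneg complex_norm_square
      flip: of_real_power)

section \<open>Gram--Schmidt orthonormalisation\<close>

definition orthonormal :: "(complex^'n) set \<Rightarrow> bool"
  where "orthonormal C \<longleftrightarrow> (\<forall>x\<in>C. \<forall>y\<in>C. herm_inner x y = (if x = y then 1 else 0))"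

text \<open>Pairing a vanishing combination with a member \<open>y\<close> of \<open>C\<close>
  isolates the coefficient of \<open>y\<close>.\<close>

lemma orthonormal_imp_independent:
  assumes "orthonormal C" "finite C"
  shows "vec.independent C"
proof (rule vec.independent_if_scalars_zero)
  fix f y assume eq: "(\<Sum>x\<in>C. f x *s x) = 0" and y: "y \<in> C"
  have "0 = herm_inner (\<Sum>x\<in>C. f x *s x) y" by (simp add: eq)
  also have "\<dots> = (\<Sum>x\<in>C. if x = y then f x else 0)"
    unfolding herm_inner_sum_left herm_inner_scale_left
    using assms(1) y by (intro sum.cong) (auto simp: orthonormal_def)
  also have "\<dots> = f y" using y assms(2) by simp
  finally show "f y = 0" by simp
qed (fact assms)

lemma orthonormal_insert:
  assumes "orthonormal C" "\<And>x. x \<in> C \<Longrightarrow> herm_inner b x = 0" "herm_inner b b = 1"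
  shows "orthonormal (insert b C)"
proof -
  have "herm_inner x b = 0" if "x \<in> C" for x
    using assms(2)[OF that] cnj_herm_inner[of b x] by simp
  then show ?thesis
    using assms unfolding orthonormal_def by auto
qed

text \<open>Modulo the span of \<open>C\<close>, the vector \<open>c\<close> is a nonzero multiple
  of \<open>b\<close>, so each can be recovered from the other. In Gram--Schmidt this lets the
  normalised residual replace the original vector.\<close>

lemma span_insert_eq:
  assumes "c - k *s b \<in> vec.span C" "k \<noteq> 0"
  shows "vec.span (insert c C) = vec.span (insert b C)"
proof -
  have c: "c = (c - k *s b) + k *s b" by simp
  have b: "b = inverse k *s c - inverse k *s (c - k *s b)"
    using assms(2) by (simp add: vec_eq_iff field_simps)
  have sub: "vec.span C \<subseteq> vec.span (insert x C)" for x
    by (intro vec.span_mono) auto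
  have "c \<in> vec.span (insert b C)"
    by (subst c, rule vec.span_add) (use assms sub in \<open>auto intro: vec.span_base vec.span_scale\<close>)
  moreover have "b \<in> vec.span (insert c C)"
    by (subst b, rule vec.span_diff; rule vec.span_scale)
       (use assms sub in \<open>auto intro: vec.span_base\<close>)
  ultimately show ?thesis
    by (intro vec.span_eq[THEN iffD2]) (auto intro: vec.span_base)
qed

text \<open>Induction on \<open>B\<close>, subtracting from the new vector its projection onto the
  span built so far. If the residual vanishes, the vector lies in that span and \<open>C\<close> is
  kept; otherwise the normalised residual joins \<open>C\<close>.\<close>

lemma gram_schmidt:
  fixes B :: "(complex^'n) set"
  assumes "finite B"
  shows "\<exists>C. finite C \<and> orthonormal C \<and> vec.span C = vec.span B"
  using assms
proof (induction B)
  case empty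
  show ?case by (intro exI[of _ "{}"]) (simp add: orthonormal_def)
next
  case (insert b B)
  then obtain C where C: "finite C" "orthonormal C" "vec.span C = vec.span B" by blast
  \<comment> \<open>The orthogonal projection of \<open>b\<close> onto the span of
    \<open>C\<close>.\<close>
  define p where "p = (\<Sum>c\<in>C. herm_inner b c *s c)"
  have p: "p \<in> vec.span C"
    unfolding p_def by (intro vec.span_sum vec.span_scale vec.span_base)
  have orth: "herm_inner (b - p) c = 0" if c: "c \<in> C" for c
  proof -
    have "herm_inner p c = (\<Sum>x\<in>C. if x = c then herm_inner b x else 0)"
      unfolding p_def herm_inner_sum_left herm_inner_scale_left
      using C(2) c by (intro sum.cong) (auto simp: orthonormal_def)
    then show ?thesis using C(1) c by (simp add: herm_inner_diff_left)
  qed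
  have span_b: "vec.span (insert b B) = vec.span (insert b C)"
    by (simp only: vec.span_insert C(3))
  show ?case
  proof (cases "b = p")
    case True
    then show ?thesis using p C span_b vec.span_redundant by metis
  next
    case False
    \<comment> \<open>The norm is taken as a complex scalar so that \<open>*s\<close> can divide by
      it; being real, it equals its own conjugate.\<close>
    define r :: complex where "r = of_real (norm (b - p))"
    define e where "e = inverse r *s (b - p)"
    have r: "r \<noteq> 0" using False by (simp add: r_def)
    have cr: "cnj r = r" by (simp add: r_def)
    have "herm_inner (b - p) (b - p) = r * r"
      by (simp add: herm_inner_self r_def power2_eq_square)
    then have "herm_inner e e = 1"
      unfolding e_def herm_inner_scale_left herm_inner_scale_right
      using r by (simp add: cr field_simps)
    moreover have "herm_inner e c = 0" if "c \<in> C" for c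
      unfolding e_def herm_inner_scale_left using orth[OF that] by simp
    ultimately have "orthonormal (insert e C)"
      using C(2) by (intro orthonormal_insert)
    moreover have "vec.span (insert e C) = vec.span (insert b C)"
    proof (rule span_insert_eq)
      have "e - inverse r *s b = (- inverse r) *s p"
        by (simp add: e_def vec_eq_iff algebra_simps)
      then show "e - inverse r *s b \<in> vec.span C"
        using p by (metis vec.span_scale)
    qed (use r in simp)
    ultimately show ?thesis using C(1) span_b by (intro exI[of _ "insert e C"]) simp
  qed
qed

lemma orthonormal_basis_exists:
  fixes S :: "(complex^'n) set"
  assumes "vec.subspace S"
  obtains C where "finite C" "orthonormal C" "vec.span C = S" "card C = vec.dim S"
proof -
  obtain B where B: "B \<subseteq> S" "vec.independent B" "S \<subseteq> vec.span B"
    using vec.basis_exists[of S] by metis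
  have "vec.span B = S" using B assms vec.span_minimal by blast
  then obtain C where C: "finite C" "orthonormal C" "vec.span C = S"
    using gram_schmidt[OF vec.finiteI_independent[OF B(2)]] by auto
  moreover have "card C = vec.dim S"
    using vec.dim_span_eq_card_independent[OF orthonormal_imp_independent] C by metis
  ultimately show ?thesis using that by blast
qed

lemma row_isometric_representation:
  fixes S :: "(complex^'n) set"
  assumes "vec.subspace S" "vec.dim S = CARD('l::finite)"
  shows "\<exists>G :: complex^'n^'l. row_space G = S \<and> G ** G\<^sup>H = mat 1"
proof -
  obtain C where C: "finite C" "orthonormal C" "vec.span C = S" "card C = CARD('l)"
    using orthonormal_basis_exists[OF assms(1)] assms(2) by metis
  then obtain f :: "'l \<Rightarrow> complex^'n" where f: "bij_betw f UNIV C"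
    using finite_same_card_bij[of "UNIV :: 'l set" C] by auto
  \<comment> \<open>The entries are conjugated because the row space is the column space of
    \<open>G\<^sup>H\<close>: its columns are then the basis vectors \<open>f i\<close>
    themselves.\<close>
  define G :: "complex^'n^'l" where "G = (\<chi> i j. cnj (f i $ j))"
  have "column i (G\<^sup>H) = f i" for i
    by (simp add: vec_eq_iff column_def G_def)
  then have "columns (G\<^sup>H) = C"
    using f by (auto simp: columns_def bij_betw_def)
  then have "row_space G = S"
    by (simp add: row_space_def col_space_def C(3))
  moreover have "(G ** G\<^sup>H) $ i $ j = (if i = j then 1 else 0)" for i j
  proof -
    \<comment> \<open>The indices swap since here the conjugate sits on \<open>f i\<close>, whereas
      \<open>herm_inner\<close> conjugates its second argument.\<close>
    have "(G ** G\<^sup>H) $ i $ j = herm_inner (f j) (f i)"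
      by (simp add: matrix_matrix_mult_def herm_inner_def G_def mult.commute)
    also have "\<dots> = (if f j = f i then 1 else 0)"
      using C(2) f by (auto simp: orthonormal_def bij_betw_def)
    also have "\<dots> = (if i = j then 1 else 0)"
      using f by (auto simp: bij_betw_def inj_on_def)
    finally show ?thesis .
  qed
  then have "G ** G\<^sup>H = mat 1"
    by (simp add: vec_eq_iff mat_def)
  ultimately show ?thesis by blast
qed

section \<open>Full row rank\<close>

text \<open>Since \<open>rows G\<close> is a set, repeated rows must be excluded first. The chain
  dimension \<le> number of distinct rows \<le> \<open>CARD('l)\<close> has equal ends, so the rows
  are pairwise distinct and independent, which yields a right inverse.\<close>

lemma full_row_rank_imp_right_invertible:
  fixes G :: "complex^'n^'l"
  assumes "full_row_rank G"
  obtains B where "G ** B = mat 1"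
proof -
  have rows: "rows G = range (\<lambda>i. row i G)" by (auto simp: rows_def)
  have "CARD('l) = vec.dim (rows G)"
    using assms by (simp add: full_row_rank_def row_rank_def_gen)
  moreover have "vec.dim (rows G) \<le> card (rows G)"
    by (intro vec.dim_le_card vec.span_superset) (simp add: rows)
  moreover have "card (rows G) \<le> CARD('l)"
    unfolding rows by (rule card_image_le) simp
  ultimately have card: "card (rows G) = CARD('l)" "card (rows G) = vec.dim (rows G)"
    by simp_all
  have inj: "inj (\<lambda>i. row i G)"
    using card(1) by (intro eq_card_imp_inj_on) (auto simp: rows)
  have ind: "vec.independent (rows G)"
    using vec.card_eq_dim[of "rows G" "rows G"] card(2) by (simp add: rows vec.span_superset)
  have "c i = 0" if eq: "(\<Sum>i\<in>UNIV. c i *s row i G) = 0" for c i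
  proof -
    \<comment> \<open>Transfers coefficients from row indices to the rows themselves; well behaved
      because distinct indices give distinct rows.\<close>
    define u where "u = c \<circ> inv (\<lambda>i. row i G)"
    have "(\<Sum>v\<in>rows G. u v *s v) = (\<Sum>i\<in>UNIV. c i *s row i G)"
      unfolding rows u_def using inj by (simp add: sum.reindex inv_f_f[OF inj])
    then have "u (row i G) = 0"
      using ind eq vec.independent_explicit[of "rows G"] by (auto simp: rows)
    then show ?thesis by (simp add: u_def inv_f_f[OF inj])
  qed
  then show ?thesis
    using matrix_right_invertible_independent_rows[of G] that by blast
qed

text \<open>Trivial kernel: if \<open>G ** G\<^sup>H\<close> annihilates \<open>x\<close>, then the
  squared norm of \<open>G\<^sup>H *v x\<close> is the pairing of
  \<open>(G ** G\<^sup>H) *v x\<close> with \<open>x\<close>, hence zero.\<close>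

lemma invertible_gram:
  fixes G :: "complex^'n^'l"
  assumes "full_row_rank G"
  shows "invertible (G ** G\<^sup>H)"
proof -
  obtain B where B: "G ** B = mat 1"
    using full_row_rank_imp_right_invertible[OF assms] .
  have "x = 0" if "(G ** G\<^sup>H) *v x = 0" for x
  proof -
    define y where "y = G\<^sup>H *v x"
    have "herm_inner y y = herm_inner (G *v y) x"
    proof -
      have "herm_inner y y = (\<Sum>j\<in>UNIV. \<Sum>i\<in>UNIV. y $ j * (G $ i $ j * cnj (x $ i)))"
        by (subst (2) y_def)
           (simp add: herm_inner_def matrix_vector_mult_def sum_distrib_left)
      also have "\<dots> = (\<Sum>i\<in>UNIV. \<Sum>j\<in>UNIV. y $ j * (G $ i $ j * cnj (x $ i)))"
        by (rule sum.swap)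
      also have "\<dots> = herm_inner (G *v y) x"
        by (simp add: herm_inner_def matrix_vector_mult_def sum_distrib_left sum_distrib_right mult_ac)
      finally show ?thesis .
    qed
    also have "G *v y = 0"
      using that by (simp add: y_def matrix_vector_mul_assoc)
    finally have "y = 0" by (simp add: herm_inner_self)
    \<comment> \<open>The adjoint of a right inverse of \<open>G\<close> is a left inverse of
      \<open>G\<^sup>H\<close>, so \<open>y = 0\<close> forces \<open>x = 0\<close>.\<close>
    have "x = (G ** B)\<^sup>H *v x" by (simp add: B)
    also have "\<dots> = B\<^sup>H *v y"
      by (simp add: conj_transpose_mult y_def matrix_vector_mul_assoc)
    finally show "x = 0" using \<open>y = 0\<close> by simp
  qed
  then show ?thesis
    unfolding invertible_left_inverse matrix_left_invertible_ker by blast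
qed

section \<open>The orthogonal projection onto the row space\<close>

text \<open>Every vector of the column space is \<open>A\<close> applied to some coefficient vector;
  the coefficient vectors of the columns of \<open>B\<close> form the columns of
  \<open>C\<close>.\<close>

lemma matrix_factor_if_columns_in_col_space:
  fixes A :: "complex^'m^'n" and B :: "complex^'p^'n"
  assumes "columns B \<subseteq> col_space A"
  shows "\<exists>C. B = A ** C"
proof -
  have "col_space A \<subseteq> range ((*v) A)"
    unfolding col_space_def
  proof (rule vec.span_minimal)
    show "columns A \<subseteq> range ((*v) A)"
      \<comment> \<open>Column \<open>i\<close> is the image of the unit vector
        \<open>axis i 1\<close>.\<close>
      by (force simp: columns_def vec_eq_iff column_def matrix_vector_mult_def axis_def
          if_distrib cong: if_cong intro!: image_eqI[of _ _ "axis i 1" for i])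
    show "vec.subspace (range ((*v) A))"
      using vec.subspace_image[OF vec.subspace_UNIV, of A] .
  qed
  then have "\<forall>j. \<exists>x. column j B = A *v x"
    using assms by (force simp: columns_def)
  then obtain f where f: "\<And>j. column j B = A *v f j" by metis
  have "B = A ** (\<chi> i j. f j $ i)"
    using f by (simp add: vec_eq_iff column_def matrix_matrix_mult_def matrix_vector_mult_def)
  then show ?thesis by blast
qed

definition row_proj :: "complex^'n^'l \<Rightarrow> complex^'n^'n"
  where "row_proj G = G\<^sup>H ** matrix_inv (G ** G\<^sup>H) ** G"

lemma matrix_inv_mult:
  assumes "invertible (A :: complex^'n^'n)"
  shows "A ** matrix_inv A = mat 1" "matrix_inv A ** A = mat 1"
  using someI_ex[OF assms[unfolded invertible_def]] by (auto simp: matrix_inv_def)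

text \<open>The Gram matrix is Hermitian, so the adjoint of its inverse is again a left inverse of
  it and must coincide with the inverse.\<close>

lemma conj_transpose_row_proj:
  assumes "full_row_rank G"
  shows "(row_proj G)\<^sup>H = row_proj G"
proof -
  define A where "A = G ** G\<^sup>H"
  have A: "A\<^sup>H = A" by (simp add: A_def conj_transpose_mult)
  have inv: "A ** matrix_inv A = mat 1" "matrix_inv A ** A = mat 1"
    using matrix_inv_mult invertible_gram[OF assms] by (auto simp: A_def)
  have "(matrix_inv A)\<^sup>H ** A = mat 1"
    using arg_cong[OF inv(1), of conj_transpose] by (simp add: conj_transpose_mult A)
  then have "(matrix_inv A)\<^sup>H = matrix_inv A"
    using inv(1) by (metis matrix_mul_assoc matrix_mul_lid matrix_mul_rid)
  then show ?thesis
    by (simp add: row_proj_def conj_transpose_mult matrix_mul_assoc flip: A_def)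
qed

text \<open>Such a \<open>B\<close> factors as \<open>G\<^sup>H ** C\<close>, and the Gram matrix
  that appears in the product cancels against its inverse.\<close>

lemma row_proj_mult_row_space:
  assumes "full_row_rank G" "columns B \<subseteq> row_space G"
  shows "row_proj G ** B = B"
proof -
  obtain C where C: "B = G\<^sup>H ** C"
    using matrix_factor_if_columns_in_col_space assms(2) unfolding row_space_def by blast
  have "row_proj G ** B = G\<^sup>H ** (matrix_inv (G ** G\<^sup>H) ** (G ** G\<^sup>H)) ** C"
    by (simp add: row_proj_def C matrix_mul_assoc)
  also have "\<dots> = B"
    by (simp add: matrix_inv_mult(2)[OF invertible_gram[OF assms(1)]] C)
  finally show ?thesis .
qed

text \<open>The leftmost factor of \<open>row_proj G'\<close> is \<open>G'\<^sup>H\<close>, whose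
  columns lie in the common row space and are therefore fixed by \<open>row_proj G\<close>.\<close>

lemma row_proj_mult_row_proj:
  assumes "full_row_rank G" "row_space G = row_space G'"
  shows "row_proj G ** row_proj G' = row_proj G'"
proof -
  have "columns (G'\<^sup>H) \<subseteq> row_space G"
    using assms(2) by (simp add: row_space_def col_space_def vec.span_superset)
  then have "row_proj G ** G'\<^sup>H = G'\<^sup>H"
    by (rule row_proj_mult_row_space[OF assms(1)])
  then show ?thesis
    by (simp add: row_proj_def[of G'] matrix_mul_assoc)
qed

lemma row_proj_cong:
  assumes "full_row_rank G" "full_row_rank G'" "row_space G = row_space G'"
  shows "row_proj G = row_proj G'"
proof -
  have "row_proj G' = (row_proj G ** row_proj G')\<^sup>H"
    using assms by (simp add: row_proj_mult_row_proj conj_transpose_row_proj)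
  also have "\<dots> = row_proj G' ** row_proj G"
    using assms by (simp add: conj_transpose_mult conj_transpose_row_proj)
  also have "\<dots> = row_proj G"
    using assms by (simp add: row_proj_mult_row_proj)
  finally show ?thesis by simp
qed

text \<open>Shows that \<open>G\<close> enters the Fisher matrix only through its row projection, so
  subspace invariance reduces to equality of projections.\<close>

lemma J_MiLAC_row_proj:
  fixes s :: "complex^'t"
  shows "J_MiLAC a s \<sigma> \<xi> G = (2 / \<sigma>\<^sup>2) *\<^sub>R map_matrix Re
    ((J_dig a s \<xi>)\<^sup>H ** ((mat 1 :: complex^'t^'t) \<otimes>\<^sub>K row_proj G) ** J_dig a s \<xi>)"
proof -
  have "(mat 1 :: complex^'t^'t) \<otimes>\<^sub>K row_proj G =
    ((mat 1 :: complex^'t^'t) \<otimes>\<^sub>K G)\<^sup>H ** (mat 1 \<otimes>\<^sub>K matrix_inv (G ** G\<^sup>H)) ** (mat 1 \<otimes>\<^sub>K G)"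
    by (simp add: conj_transpose_kron kron_mult row_proj_def)
  then show ?thesis
    by (simp add: J_MiLAC_def matrix_mul_assoc)
qed

theorem proposition1:
  fixes a :: "real \<Rightarrow> complex^'n"
    and \<xi> :: "real^('k::finite) param"
    and s :: "complex^'t"
    and \<sigma> :: real
  assumes "a differentiable_on UNIV"
    and "inj (angle \<xi>)"
    and "\<forall>k. gain \<xi> k \<noteq> 0"
    and "\<sigma>\<^sup>2 > 0"
    and "CARD('l::finite) \<le> CARD('n)"
  shows "(\<forall>(G :: complex^'n^'l) (G' :: complex^'n^'l).
            full_row_rank G \<and> full_row_rank G' \<and> row_space G = row_space G' \<longrightarrow>
            J_MiLAC a s \<sigma> \<xi> G = J_MiLAC a s \<sigma> \<xi> G') \<and>
         (\<forall>S :: (complex^'n) set.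
            vec.subspace S \<and> vec.dim S = CARD('l) \<longrightarrow>
            (\<exists>G_iso :: complex^'n^'l. row_space G_iso = S \<and> G_iso ** G_iso\<^sup>H = mat 1))"
proof (intro conjI allI impI)
  fix G G' :: "complex^'n^'l"
  assume "full_row_rank G \<and> full_row_rank G' \<and> row_space G = row_space G'"
  then have "row_proj G = row_proj G'"
    using row_proj_cong by blast
  then show "J_MiLAC a s \<sigma> \<xi> G = J_MiLAC a s \<sigma> \<xi> G'"
    by (simp add: J_MiLAC_row_proj)
qed (simp add: row_isometric_representation)

end
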